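(* Let $\{X_N\}_{N\in\mathbb{N}}$ be a sequence of finite dimensional subspaces of $W_0^{1,\infty}(\Omega)$ with $X_0\subset X_1\subset\dots\subset X_N\subset X_{N+1}\subset\cdots\subset W_0^{1,\infty}(\Omega)$, and assume that their union is dense in $W_0^{1,p(\cdot)}(\Omega)$, i.e. $$\overline{\bigcup_{N\in\mathbb{N}}X_N}^{\,\|\cdot\|_{W_0^{1,p(\cdot)}(\Omega)}}=W_0^{1,p(\cdot)}(\Omega).$$ Let $f\in L^{\alpha(\cdot)}(\Omega)$ with $\alpha\in C_+(\overline\Omega)$, $\frac1{\alpha(x)}+\frac1{p^\star(x)}<1$ for all $x\in\Omega$, and suppose that $\alpha_-:=\min_{\overline\Omega}\alpha$ satisfies $\alpha_->1$ if $d=2$ and $\alpha_-\ge\frac65$ if $d=3$. Let $u^\star\in W_0^{1,p(\cdot)}(\Omega)$ be the unique solution of $$\int_\Omega|\nabla u|^{p(x)-2}\nabla u\cdot\nabla v\,dx=\int_\Omega fv\,dx\qquad\text{for all }v\in W_0^{1,p(\cdot)}(\Omega),$$ and let $u_N^\star\in X_N$ be the unique solution in $X_N$ of the same equation tested with all $v\in X_N$. Then $\mathsf{E}(u_N^\star)\to\mathsf{E}(u^\star)$ as $N\to\infty$.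
   Context: Setting: $\Omega\subset\mathbb{R}^d$, $d\in\{2,3\}$, is open and bounded with Lipschitz boundary. $C_+(\overline\Omega)=\{g\in C(\overline\Omega):\inf_{\overline\Omega} g>1\}$, and $p\in C_+(\overline\Omega)$ is given. $p^\star(x)=\frac{d\,p(x)}{d-p(x)}$ if $p(x)<d$ and $p^\star(x)=\infty$ if $p(x)\ge d$ (with $1/\infty=0$). Spaces: for $q\in C_+(\overline\Omega)$, $L^{q(\cdot)}(\Omega)$ is the set of measurable $g$ with $\int_\Omega|g(x)|^{q(x)}dx<\infty$, with the Luxemburg norm $\|g\|_{L^{q(\cdot)}(\Omega)}=\inf\{\lambda>0:\int_\Omega|g(x)/\lambda|^{q(x)}dx\le1\}$. $W^{1,p(\cdot)}(\Omega)=\{g\in L^{p(\cdot)}(\Omega):\nabla g\in L^{p(\cdot)}(\Omega)\}$ with norm $\|\nabla g\|_{L^{p(\cdot)}(\Omega)}+\|g\|_{L^{p(\cdot)}(\Omega)}$. $W_0^{1,p(\cdot)}(\Omega)$ is the closure of $C_0^\infty(\Omega)$ in $W^{1,p(\cdot)}(\Omega)$, endowed with the norm $\|g\|_{W_0^{1,p(\cdot)}(\Omega)}=\|\nabla g\|_{L^{p(\cdot)}(\Omega)}$. $W_0^{1,\infty}(\Omega)$ is the space of $W^{1,\infty}$ functions with zero trace on $\partial\Omega$; it is contained in $W_0^{1,p(\cdot)}(\Omega)$. Energy: $\mathsf{E}(u)=\int_\Omega\frac1{p(x)}|\nabla u|^{p(x)}dx-\int_\Omega fu\,dx$ for $u\in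 W_0^{1,p(\cdot)}(\Omega)$. The solutions $u^\star$ and $u_N^\star$ are, equivalently, the unique minimisers of $\mathsf{E}$ over $W_0^{1,p(\cdot)}(\Omega)$ and $X_N$, respectively. *)

theory Defs
  imports "HOL-Analysis.Analysis"
begin

text \<open>
  Elements of Lebesgue and Sobolev spaces are represented by total functions on the ambient
  space.  Their values outside \<open>\<Omega>\<close> are irrelevant and functions that agree almost everywhere
  on \<open>\<Omega>\<close> represent the same element.
\<close>

text \<open>
  Near each boundary point, \<open>\<Omega>\<close> is the strict epigraph of a Lipschitz function \<open>\<gamma>\<close> of the
  coordinates orthogonal to a unit direction \<open>\<nu>\<close>, i.e. after a rotation of the axes.
\<close>
definition lipschitz_boundary :: "(real ^ 'n) set \<Rightarrow> bool" where
  "lipschitz_boundary \<Omega> \<longleftrightarrow>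
     (\<forall>x0 \<in> frontier \<Omega>. \<exists>r > 0. \<exists>\<nu> L \<gamma>.
        norm \<nu> = 1 \<and> L-lipschitz_on {z. z \<bullet> \<nu> = 0} \<gamma> \<and>
        \<Omega> \<inter> ball x0 r = {y \<in> ball x0 r. y \<bullet> \<nu> > \<gamma> (y - (y \<bullet> \<nu>) *\<^sub>R \<nu>)})"

definition C_plus :: "(real ^ 'n) set \<Rightarrow> (real ^ 'n \<Rightarrow> real) set" where
  "C_plus \<Omega> = {g. continuous_on (closure \<Omega>) g \<and> (INF x \<in> closure \<Omega>. g x) > 1}"

definition p_star :: "(real ^ 'n \<Rightarrow> real) \<Rightarrow> real ^ 'n \<Rightarrow> ereal" where
  "p_star p x =
     (if p x < real CARD('n) then ereal (real CARD('n) * p x / (real CARD('n) - p x)) else \<infinity>)"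


subsection \<open>Variable exponent Lebesgue spaces\<close>

definition modular ::
  "(real ^ 'n) set \<Rightarrow> (real ^ 'n \<Rightarrow> real) \<Rightarrow> (real ^ 'n \<Rightarrow> 'b::real_normed_vector) \<Rightarrow> ennreal" where
  "modular \<Omega> q g = (\<integral>\<^sup>+ x. ennreal (norm (g x) powr q x) \<partial>lebesgue_on \<Omega>)"

definition Lvar ::
  "(real ^ 'n) set \<Rightarrow> (real ^ 'n \<Rightarrow> real) \<Rightarrow> (real ^ 'n \<Rightarrow> 'b::real_normed_vector) set" where
  "Lvar \<Omega> q = {g \<in> borel_measurable (lebesgue_on \<Omega>). modular \<Omega> q g < \<infinity>}"

definition Lvar_norm ::
  "(real ^ 'n) set \<Rightarrow> (real ^ 'n \<Rightarrow> real) \<Rightarrow> (real ^ 'n \<Rightarrow> 'b::real_normed_vector) \<Rightarrow> real" where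
  "Lvar_norm \<Omega> q g = Inf {l. l > 0 \<and> modular \<Omega> q (\<lambda>x. g x /\<^sub>R l) \<le> 1}"

definition Linf :: "(real ^ 'n) set \<Rightarrow> (real ^ 'n \<Rightarrow> 'b::real_normed_vector) set" where
  "Linf \<Omega> = {g \<in> borel_measurable (lebesgue_on \<Omega>). \<exists>C. AE x in lebesgue_on \<Omega>. norm (g x) \<le> C}"


subsection \<open>Test functions and weak gradients\<close>

definition partial_deriv :: "'n \<Rightarrow> (real ^ 'n \<Rightarrow> real) \<Rightarrow> real ^ 'n \<Rightarrow> real" where
  "partial_deriv i \<phi> x = frechet_derivative \<phi> (at x) (axis i 1)"

primrec C_k :: "nat \<Rightarrow> (real ^ 'n \<Rightarrow> real) \<Rightarrow> bool" where
  "C_k 0 \<phi> \<longleftrightarrow> continuous_on UNIV \<phi>"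
| "C_k (Suc k) \<phi> \<longleftrightarrow> (\<forall>x. \<phi> differentiable at x) \<and> (\<forall>i. C_k k (partial_deriv i \<phi>))"

text \<open>\<open>C\<^sub>0\<^sup>\<infinity>(\<Omega>)\<close>, each function being extended by zero to the whole space.\<close>
definition test_functions :: "(real ^ 'n) set \<Rightarrow> (real ^ 'n \<Rightarrow> real) set" where
  "test_functions \<Omega> =
     {\<phi>. (\<forall>k. C_k k \<phi>) \<and> compact (closure {x. \<phi> x \<noteq> 0}) \<and> closure {x. \<phi> x \<noteq> 0} \<subseteq> \<Omega>}"

definition locally_integrable ::
  "(real ^ 'n) set \<Rightarrow> (real ^ 'n \<Rightarrow> 'b::{banach, second_countable_topology}) \<Rightarrow> bool" where
  "locally_integrable \<Omega> g \<longleftrightarrow> (\<forall>K. compact K \<and> K \<subseteq> \<Omega> \<longrightarrow> set_integrable lebesgue K g)"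

definition is_weak_gradient ::
  "(real ^ 'n) set \<Rightarrow> (real ^ 'n \<Rightarrow> real) \<Rightarrow> (real ^ 'n \<Rightarrow> real ^ 'n) \<Rightarrow> bool" where
  "is_weak_gradient \<Omega> g G \<longleftrightarrow>
     locally_integrable \<Omega> g \<and> locally_integrable \<Omega> G \<and>
     (\<forall>\<phi> \<in> test_functions \<Omega>. \<forall>i.
        (LINT x|lebesgue_on \<Omega>. g x * partial_deriv i \<phi> x) =
          - (LINT x|lebesgue_on \<Omega>. (G x $ i) * \<phi> x))"

definition weakly_differentiable :: "(real ^ 'n) set \<Rightarrow> (real ^ 'n \<Rightarrow> real) \<Rightarrow> bool" where
  "weakly_differentiable \<Omega> g \<longleftrightarrow> (\<exists>G. is_weak_gradient \<Omega> g G)"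

text \<open>A weak gradient is determined almost everywhere on \<open>\<Omega>\<close>; one representative is chosen.\<close>
definition wgrad :: "(real ^ 'n) set \<Rightarrow> (real ^ 'n \<Rightarrow> real) \<Rightarrow> real ^ 'n \<Rightarrow> real ^ 'n" where
  "wgrad \<Omega> g = (SOME G. is_weak_gradient \<Omega> g G)"


subsection \<open>Sobolev spaces\<close>

definition W1 :: "(real ^ 'n) set \<Rightarrow> (real ^ 'n \<Rightarrow> real) \<Rightarrow> (real ^ 'n \<Rightarrow> real) set" where
  "W1 \<Omega> p = {g \<in> Lvar \<Omega> p. weakly_differentiable \<Omega> g \<and> wgrad \<Omega> g \<in> Lvar \<Omega> p}"

definition W1_norm :: "(real ^ 'n) set \<Rightarrow> (real ^ 'n \<Rightarrow> real) \<Rightarrow> (real ^ 'n \<Rightarrow> real) \<Rightarrow> real" where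
  "W1_norm \<Omega> p g = Lvar_norm \<Omega> p (wgrad \<Omega> g) + Lvar_norm \<Omega> p g"

definition W10 :: "(real ^ 'n) set \<Rightarrow> (real ^ 'n \<Rightarrow> real) \<Rightarrow> (real ^ 'n \<Rightarrow> real) set" where
  "W10 \<Omega> p =
     {g \<in> W1 \<Omega> p. \<forall>e > 0. \<exists>\<phi> \<in> test_functions \<Omega>. W1_norm \<Omega> p (\<lambda>x. g x - \<phi> x) < e}"

definition W10_norm :: "(real ^ 'n) set \<Rightarrow> (real ^ 'n \<Rightarrow> real) \<Rightarrow> (real ^ 'n \<Rightarrow> real) \<Rightarrow> real" where
  "W10_norm \<Omega> p g = Lvar_norm \<Omega> p (wgrad \<Omega> g)"

definition W1inf :: "(real ^ 'n) set \<Rightarrow> (real ^ 'n \<Rightarrow> real) set" where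
  "W1inf \<Omega> = {g \<in> Linf \<Omega>. weakly_differentiable \<Omega> g \<and> wgrad \<Omega> g \<in> Linf \<Omega>}"

text \<open>
  On a bounded Lipschitz domain every \<open>W\<^sup>1\<^sup>,\<^sup>\<infinity>\<close> function has a representative that is continuous
  up to the boundary; its trace is the restriction of that representative to the boundary.
\<close>
definition has_trace ::
  "(real ^ 'n) set \<Rightarrow> (real ^ 'n \<Rightarrow> real) \<Rightarrow> (real ^ 'n \<Rightarrow> real) \<Rightarrow> bool" where
  "has_trace \<Omega> g t \<longleftrightarrow>
     (\<exists>h. continuous_on (closure \<Omega>) h \<and> (AE x in lebesgue_on \<Omega>. g x = h x) \<and>
          (\<forall>x \<in> frontier \<Omega>. h x = t x))"

definition W10inf :: "(real ^ 'n) set \<Rightarrow> (real ^ 'n \<Rightarrow> real) set" where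
  "W10inf \<Omega> = {g \<in> W1inf \<Omega>. has_trace \<Omega> g (\<lambda>_. 0)}"

text \<open>
  The closure is taken in the normed space \<open>W10 \<Omega> p\<close>; outside that space \<open>W10_norm\<close> is only a
  seminorm.  Its being equal to \<open>W10 \<Omega> p\<close> includes that \<open>S\<close> is a subset of that space.
\<close>
definition dense_in_W10 ::
  "(real ^ 'n) set \<Rightarrow> (real ^ 'n \<Rightarrow> real) \<Rightarrow> (real ^ 'n \<Rightarrow> real) set \<Rightarrow> bool" where
  "dense_in_W10 \<Omega> p S \<longleftrightarrow>
     S \<subseteq> W10 \<Omega> p \<and>
     {g \<in> W10 \<Omega> p. \<forall>e > 0. \<exists>v \<in> S. W10_norm \<Omega> p (\<lambda>x. g x - v x) < e} = W10 \<Omega> p"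

text \<open>
  Since elements are functions modulo equality almost everywhere on \<open>\<Omega>\<close>, finite dimension means
  that finitely many elements span the space up to such equality.
\<close>
definition fin_dim_subspace :: "(real ^ 'n) set \<Rightarrow> (real ^ 'n \<Rightarrow> real) set \<Rightarrow> bool" where
  "fin_dim_subspace \<Omega> X \<longleftrightarrow>
     (\<lambda>_. 0) \<in> X \<and>
     (\<forall>g \<in> X. \<forall>h \<in> X. (\<lambda>x. g x + h x) \<in> X) \<and>
     (\<forall>c. \<forall>g \<in> X. (\<lambda>x. c * g x) \<in> X) \<and>
     (\<exists>B. finite B \<and> B \<subseteq> X \<and>
        (\<forall>g \<in> X. \<exists>c. AE x in lebesgue_on \<Omega>. g x = (\<Sum>b\<in>B. c b * b x)))"


subsection \<open>The \<open>p(x)\<close>-Laplace problem\<close>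

text \<open>
  \<open>V\<close> is both the trial and the test space.  Where \<open>\<nabla>u\<close> vanishes, \<open>0 powr a = 0\<close> gives the
  usual convention that \<open>|\<nabla>u|\<^sup>p\<^sup>-\<^sup>2\<nabla>u\<close> is zero there, also for \<open>p < 2\<close>.
\<close>
definition solves_weakly ::
  "(real ^ 'n) set \<Rightarrow> (real ^ 'n \<Rightarrow> real) \<Rightarrow> (real ^ 'n \<Rightarrow> real) \<Rightarrow> (real ^ 'n \<Rightarrow> real) set \<Rightarrow>
     (real ^ 'n \<Rightarrow> real) \<Rightarrow> bool" where
  "solves_weakly \<Omega> p f V u \<longleftrightarrow>
     u \<in> V \<and>
     (\<forall>v \<in> V.
        (LINT x|lebesgue_on \<Omega>.
           (norm (wgrad \<Omega> u x) powr (p x - 2) *\<^sub>R wgrad \<Omega> u x) \<bullet> wgrad \<Omega> v x) =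
        (LINT x|lebesgue_on \<Omega>. f x * v x))"

definition energy ::
  "(real ^ 'n) set \<Rightarrow> (real ^ 'n \<Rightarrow> real) \<Rightarrow> (real ^ 'n \<Rightarrow> real) \<Rightarrow> (real ^ 'n \<Rightarrow> real) \<Rightarrow> real" where
  "energy \<Omega> p f u =
     (LINT x|lebesgue_on \<Omega>. 1 / p x * norm (wgrad \<Omega> u x) powr p x) -
     (LINT x|lebesgue_on \<Omega>. f x * u x)"

end

theory Submission
  imports Defs
begin

text \<open>
  Write \<open>a(x, \<xi>) = |\<xi>|\<^sup>p\<^sup>(\<^sup>x\<^sup>)\<^sup>-\<^sup>2 \<xi>\<close>.  This flux is the gradient of the convex energy density
  \<open>|\<xi>|\<^sup>p\<^sup>(\<^sup>x\<^sup>) / p(x)\<close>.  If \<open>u\<close> solves the weak problem in a space \<open>V\<close>, then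
  \<open>\<integral> f v = \<integral> a(x, \<nabla>u) \<bullet> \<nabla>v\<close> for every \<open>v \<in> V\<close>, so on \<open>V\<close> the energy is
  \<open>E(v) = \<integral> |\<nabla>v|\<^sup>p\<^sup>(\<^sup>x\<^sup>) / p(x) - a(x, \<nabla>u) \<bullet> \<nabla>v\<close>: the equation itself turns the source term into
  an integral of gradients, which is under control as soon as \<open>\<nabla>u\<close> and \<open>\<nabla>v\<close> have finite modular.
  Two pointwise estimates of the Bregman distance of the density,
  \<open>|\<eta>|\<^sup>p / p - |\<xi>|\<^sup>p / p - a(\<xi>) \<bullet> (\<eta> - \<xi>)\<close>, then give everything.

  It is nonnegative (\<open>powr_norm_subgradient\<close>), so a weak solution in \<open>V\<close> minimises the energy over
  \<open>V\<close> (\<open>energy_solution_le\<close>).  It is at most \<open>A(\<epsilon>) |\<xi>|\<^sup>p + B(\<epsilon>) |\<eta> - \<xi>|\<^sup>p\<close> with \<open>A(\<epsilon>) \<rightarrow> 0\<close> as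
  \<open>\<epsilon> \<rightarrow> 0\<close> (\<open>powr_norm_excess\<close>), so the energy of \<open>v\<close> is close to that of \<open>u\<close> when the modular of
  \<open>\<nabla>v - \<nabla>u\<close> is small (\<open>energy_excess_le\<close>).  By density some \<open>X M\<close> contains a \<open>v\<close> whose energy
  exceeds that of \<open>u_star\<close> by less than \<open>e\<close> (\<open>energy_near_solution\<close>), and by nestedness
  \<open>E(u_star) \<le> E(u_N N) \<le> E(v) < E(u_star) + e\<close> for all \<open>N \<ge> M\<close>.

  The distance in the density assumption is measured by the chosen weak gradient of the difference
  \<open>u_star - v\<close>, while the estimates need the difference of the chosen weak gradients.  These agree
  almost everywhere because weak gradients are unique (\<open>is_weak_gradient_unique\<close>), which is the
  fundamental lemma of the calculus of variations (\<open>AE_zero_if_test_integrals_zero\<close>) and requires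
  a supply of test functions (\<open>box_bump_test_function\<close>).
\<close>

section \<open>Smooth bump functions\<close>

text \<open>
  A derivative chain of length \<open>k\<close> whose last member is continuous.  The recursive form makes the
  closure properties inductions on \<open>k\<close>, without Leibniz formulas for higher derivatives.
\<close>
primrec times_differentiable :: "nat \<Rightarrow> (real \<Rightarrow> real) \<Rightarrow> bool" where
  "times_differentiable 0 f \<longleftrightarrow> continuous_on UNIV f"
| "times_differentiable (Suc k) f \<longleftrightarrow>
     (\<exists>f'. (\<forall>t. (f has_real_derivative f' t) (at t)) \<and> times_differentiable k f')"

lemma times_differentiable_Suc_D: "times_differentiable (Suc k) f \<Longrightarrow> times_differentiable k f"
proof (induction k arbitrary: f)
  case 0
  then obtain f' where "\<And>t. (f has_real_derivative f' t) (at t)" by auto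
  then show ?case by (auto intro: DERIV_continuous_on)
next
  case (Suc k)
  then show ?case by (metis times_differentiable.simps(2))
qed

lemma times_differentiable_add:
  "times_differentiable k f \<Longrightarrow> times_differentiable k g \<Longrightarrow> times_differentiable k (\<lambda>t. f t + g t)"
proof (induction k arbitrary: f g)
  case 0
  then show ?case by (auto intro: continuous_on_add)
next
  case (Suc k)
  from Suc.prems obtain f' g' where
    "\<And>t. (f has_real_derivative f' t) (at t)" "times_differentiable k f'"
    "\<And>t. (g has_real_derivative g' t) (at t)" "times_differentiable k g'" by auto
  then show ?case
    by (auto intro!: exI[of _ "\<lambda>t. f' t + g' t"] DERIV_add Suc.IH)
qed

lemma times_differentiable_mult:
  "times_differentiable k f \<Longrightarrow> times_differentiable k g \<Longrightarrow> times_differentiable k (\<lambda>t. f t * g t)"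
proof (induction k arbitrary: f g)
  case 0
  then show ?case by (auto intro: continuous_on_mult)
next
  case (Suc k)
  from Suc.prems obtain f' g' where *:
    "\<And>t. (f has_real_derivative f' t) (at t)" "times_differentiable k f'"
    "\<And>t. (g has_real_derivative g' t) (at t)" "times_differentiable k g'" by auto
  have "times_differentiable k f" "times_differentiable k g"
    using Suc.prems by (blast intro: times_differentiable_Suc_D)+
  then have "times_differentiable k (\<lambda>t. f' t * g t + g' t * f t)"
    using * by (intro times_differentiable_add Suc.IH)
  moreover have "((\<lambda>t. f t * g t) has_real_derivative f' t * g t + g' t * f t) (at t)" for t
    using DERIV_mult[OF *(1,3)] by simp
  ultimately show ?case
    by (auto intro!: exI[of _ "\<lambda>t. f' t * g t + g' t * f t"])
qed

lemma times_differentiable_const: "times_differentiable k (\<lambda>t. c)"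
  by (induction k arbitrary: c) (auto intro!: exI[of _ "\<lambda>t. 0"])

lemma times_differentiable_affine:
  "times_differentiable k f \<Longrightarrow> times_differentiable k (\<lambda>t. f (a * t + b))"
proof (induction k arbitrary: f)
  case 0
  then have "continuous_on UNIV f" by simp
  then have "continuous_on UNIV (\<lambda>t. f (a * t + b))"
    by (rule continuous_on_compose2) (auto intro!: continuous_intros)
  then show ?case by simp
next
  case (Suc k)
  from Suc.prems obtain f' where *:
    "\<And>t. (f has_real_derivative f' t) (at t)" "times_differentiable k f'" by auto
  have "((\<lambda>t. f (a * t + b)) has_real_derivative f' (a * t + b) * a) (at t)" for t
    by (rule DERIV_chain2[OF *(1)]) (auto intro!: derivative_eq_intros)
  moreover have "times_differentiable k (\<lambda>t. f' (a * t + b) * a)"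
    using * by (intro times_differentiable_mult times_differentiable_const Suc.IH)
  ultimately show ?case
    by (auto intro!: exI[of _ "\<lambda>t. f' (a * t + b) * a"])
qed

text \<open>
  The flat function \<open>exp (-1/t)\<close> and its derivatives: differentiation only changes the polynomial
  factor in \<open>1/t\<close>, so this family is closed under differentiation and smoothness is an induction.
\<close>
definition flat :: "real poly \<Rightarrow> real \<Rightarrow> real" where
  "flat P t = (if t > 0 then poly P (1 / t) * exp (- (1 / t)) else 0)"

lemma poly_mult_exp_neg_tendsto_0:
  fixes P :: "real poly"
  shows "((\<lambda>s. poly P s * exp (- s)) \<longlongrightarrow> 0) at_top"
proof -
  have "((\<lambda>s. \<Sum>i\<le>degree P. coeff P i * (s ^ i / exp s)) \<longlongrightarrow> (\<Sum>i\<le>degree P. coeff P i * 0)) at_top"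
    by (intro tendsto_intros tendsto_power_div_exp_0)
  then show ?thesis
    by (simp add: poly_altdef sum_distrib_right exp_minus divide_inverse mult.assoc)
qed

text \<open>
  For \<open>t > 0\<close> this is the product rule.  At \<open>0\<close> the difference quotient on the right is
  \<open>s P(s) exp (-s)\<close> at \<open>s = 1/t\<close>, and the exponential beats the polynomial as \<open>s\<close> grows.
\<close>
lemma flat_has_derivative:
  "(flat P has_real_derivative flat (monom 1 2 * (P - pderiv P)) t) (at t)"
proof (cases "t = 0")
  case False
  show ?thesis
  proof (cases "t > 0")
    case True
    have "((\<lambda>t. poly P (1 / t) * exp (- (1 / t))) has_real_derivative
            flat (monom 1 2 * (P - pderiv P)) t) (at t)"
      using True
      by (auto intro!: derivative_eq_intros DERIV_chain2[OF poly_DERIV]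
          simp: flat_def poly_monom power2_eq_square algebra_simps divide_simps)
    then show ?thesis
      by (rule has_field_derivative_transform_within_open[where S = "{0<..}"])
         (use True in \<open>auto simp: flat_def\<close>)
  next
    case False
    have "((\<lambda>t. 0) has_real_derivative flat (monom 1 2 * (P - pderiv P)) t) (at t)"
      using False by (simp add: flat_def)
    then show ?thesis
      by (rule has_field_derivative_transform_within_open[where S = "{..<0}"])
         (use False \<open>t \<noteq> 0\<close> in \<open>auto simp: flat_def\<close>)
  qed
next
  case True
  have "((\<lambda>s. poly (pCons 0 P) (1 / s) * exp (- (1 / s))) \<longlongrightarrow> 0) (at_right 0)"
    using filterlim_compose[OF poly_mult_exp_neg_tendsto_0[of "pCons 0 P"] filterlim_inverse_at_top_right]
    by (simp add: divide_inverse)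
  then have "((\<lambda>s. flat P s / s) \<longlongrightarrow> 0) (at_right 0)"
    by (rule Lim_transform_eventually)
       (auto simp: flat_def eventually_at_right_less divide_simps intro!: eventually_mono[OF eventually_at_right_less[of 0]])
  moreover have "((\<lambda>s. flat P s / s) \<longlongrightarrow> 0) (at_left 0)"
    by (rule Lim_transform_eventually[OF tendsto_const])
       (auto simp: flat_def eventually_at_filter)
  ultimately have "((\<lambda>s. flat P s / s) \<longlongrightarrow> 0) (at 0)"
    by (rule filterlim_split_at[rotated])
  then show ?thesis
    using True by (simp add: has_field_derivative_iff flat_def)
qed

lemma times_differentiable_flat: "times_differentiable k (flat P)"
proof (induction k arbitrary: P)
  case 0
  show ?case using flat_has_derivative by (auto intro: DERIV_continuous_on)
next
  case (Suc k)
  then show ?case using flat_has_derivative by auto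
qed

text \<open>
  Differentiating a product of one-variable functions in direction \<open>j\<close> replaces the \<open>j\<close>-th factor
  by its derivative.  The result has the same form, so the induction never meets a sum.
\<close>
lemma C_k_prod:
  fixes \<theta> :: "'n::finite \<Rightarrow> real \<Rightarrow> real"
  assumes "\<And>i. times_differentiable k (\<theta> i)"
  shows "C_k k (\<lambda>x :: real ^ 'n. \<Prod>i\<in>UNIV. \<theta> i (x $ i))"
  using assms
proof (induction k arbitrary: \<theta>)
  case 0
  then have "continuous_on UNIV (\<theta> i)" for i by simp
  then have "continuous_on UNIV (\<lambda>x :: real ^ 'n. \<theta> i (x $ i))" for i
    by (rule continuous_on_compose2) (auto intro!: continuous_intros)
  then show ?case by (auto intro!: continuous_on_prod)
next
  case (Suc k)
  have "\<exists>f'. (\<forall>t. (\<theta> i has_real_derivative f' t) (at t)) \<and> times_differentiable k f'" for i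
    using Suc.prems[of i] by simp
  then obtain \<theta>' where d: "\<And>i t. (\<theta> i has_real_derivative \<theta>' i t) (at t)"
    and k: "\<And>i. times_differentiable k (\<theta>' i)" by metis
  \<comment> \<open>the Leibniz rule for a finite product\<close>
  have D: "((\<lambda>x :: real ^ 'n. \<Prod>i\<in>UNIV. \<theta> i (x $ i)) has_derivative
        (\<lambda>h. \<Sum>i\<in>UNIV. (\<theta>' i (x $ i) * h $ i) * (\<Prod>j\<in>UNIV - {i}. \<theta> j (x $ j)))) (at x)" for x
  proof (rule has_derivative_prod)
    fix i
    have "(\<theta> i has_derivative (\<lambda>h. \<theta>' i (x $ i) * h)) (at (x $ i))"
      using d[of i] by (simp add: has_field_derivative_def)
    from has_derivative_compose[OF bounded_linear.has_derivative[OF bounded_linear_vec_nth[of i] has_derivative_ident] this]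
    show "((\<lambda>x. \<theta> i (x $ i)) has_derivative (\<lambda>h. \<theta>' i (x $ i) * h $ i)) (at x)" by simp
  qed
  have P: "partial_deriv j (\<lambda>x. \<Prod>i\<in>UNIV. \<theta> i (x $ i)) =
      (\<lambda>x. \<Prod>i\<in>UNIV. (if i = j then \<theta>' i else \<theta> i) (x $ i))" for j
  proof
    fix x :: "real ^ 'n"
    have "partial_deriv j (\<lambda>x. \<Prod>i\<in>UNIV. \<theta> i (x $ i)) x =
        (\<Sum>i\<in>UNIV. (\<theta>' i (x $ i) * axis j 1 $ i) * (\<Prod>l\<in>UNIV - {i}. \<theta> l (x $ l)))"
      unfolding partial_deriv_def frechet_derivative_at[OF D[of x], symmetric] by simp
    also have "\<dots> = \<theta>' j (x $ j) * (\<Prod>l\<in>UNIV - {j}. \<theta> l (x $ l))"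
      by (subst sum.remove[of _ j]) (auto simp: axis_def intro!: sum.neutral)
    also have "\<dots> = (\<Prod>i\<in>UNIV. (if i = j then \<theta>' i else \<theta> i) (x $ i))"
      by (subst (2) prod.remove[of _ j]) (auto intro!: prod.cong)
    finally show "partial_deriv j (\<lambda>x. \<Prod>i\<in>UNIV. \<theta> i (x $ i)) x =
      (\<Prod>i\<in>UNIV. (if i = j then \<theta>' i else \<theta> i) (x $ i))" .
  qed
  have "C_k k (\<lambda>x. \<Prod>i\<in>UNIV. (if i = j then \<theta>' i else \<theta> i) (x $ i))" for j
    by (rule Suc.IH) (auto intro: k times_differentiable_Suc_D[OF Suc.prems])
  then show ?case
    using D by (auto simp: P differentiable_def)
qed

text \<open>
  The factor \<open>n + 1\<close> compresses the flat functions towards the faces of the box, so that the bumps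
  increase to the indicator of the open box while their support stays the same.
\<close>
definition box_bump :: "real ^ 'n \<Rightarrow> real ^ 'n \<Rightarrow> nat \<Rightarrow> real ^ 'n \<Rightarrow> real" where
  "box_bump a b n x =
     (\<Prod>i\<in>UNIV. flat 1 (real (Suc n) * (x $ i - a $ i)) * flat 1 (real (Suc n) * (b $ i - x $ i)))"

lemma flat_1_bounds: "0 \<le> flat 1 t" "flat 1 t \<le> 1" "flat 1 t \<noteq> 0 \<longleftrightarrow> t > 0"
  by (auto simp: flat_def)

lemma flat_1_dilation_tendsto:
  "(\<lambda>n. flat 1 (real (Suc n) * t)) \<longlonglongrightarrow> (if t > 0 then 1 else 0)"
proof (cases "t > 0")
  case True
  have "(\<lambda>n. exp (- (inverse (real (Suc n)) * (1 / t)))) \<longlonglongrightarrow> exp (- (0 * (1 / t)))"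
    by (intro tendsto_intros LIMSEQ_inverse_real_of_nat)
  then show ?thesis
    using True by (simp add: flat_def divide_simps del: of_nat_Suc)
next
  case False
  then have "flat 1 (real (Suc n) * t) = 0" for n
    by (simp add: flat_def zero_less_mult_iff)
  then show ?thesis using False by simp
qed

lemma box_bump_nonzero_iff: "box_bump a b n x \<noteq> 0 \<longleftrightarrow> x \<in> box a b"
proof -
  have *: "flat 1 (real (Suc n) * t) = 0 \<longleftrightarrow> \<not> t > 0" for t
    using flat_1_bounds(3)[of "real (Suc n) * t"] by (auto simp: zero_less_mult_iff)
  show ?thesis
    by (auto simp: box_bump_def * mem_box_cart simp del: of_nat_Suc)
qed

lemma box_bump_bounds: "0 \<le> box_bump a b n x" "box_bump a b n x \<le> 1"
  unfolding box_bump_def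
  by (intro prod_nonneg ballI mult_nonneg_nonneg flat_1_bounds prod_le_1 conjI mult_le_one)+

lemma box_bump_tendsto: "(\<lambda>n. box_bump a b n x) \<longlonglongrightarrow> indicator (box a b) x"
proof -
  let ?L = "\<Prod>i\<in>UNIV. (if x $ i - a $ i > 0 then 1 else 0) * (if b $ i - x $ i > 0 then 1 else 0) :: real"
  have "(\<lambda>n. box_bump a b n x) \<longlonglongrightarrow> ?L"
    unfolding box_bump_def by (intro tendsto_prod tendsto_mult flat_1_dilation_tendsto)
  also have "?L = indicator (box a b) x"
  proof (cases "x \<in> box a b")
    case True
    then show ?thesis by (auto simp: mem_box_cart)
  next
    case False
    then obtain i where "\<not> (a $ i < x $ i \<and> x $ i < b $ i)" by (auto simp: mem_box_cart)
    then show ?thesis using False by (auto simp: intro!: bexI[of _ i])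
  qed
  finally show ?thesis .
qed

lemma box_bump_test_function:
  assumes "closure (box a b) \<subseteq> \<Omega>"
  shows "box_bump a b n \<in> test_functions \<Omega>"
proof -
  have "times_differentiable k
      (\<lambda>t. flat 1 (real (Suc n) * (t - a $ i)) * flat 1 (real (Suc n) * (b $ i - t)))" for k i
    using times_differentiable_mult[OF
        times_differentiable_affine[OF times_differentiable_flat, of k 1 "real (Suc n)" "- (real (Suc n) * a $ i)"]
        times_differentiable_affine[OF times_differentiable_flat, of k 1 "- real (Suc n)" "real (Suc n) * b $ i"]]
    by (simp add: right_diff_distrib del: of_nat_Suc)
  from C_k_prod[OF this] have "C_k k (box_bump a b n)" for k
    unfolding box_bump_def[abs_def] .
  moreover have "{x. box_bump a b n x \<noteq> 0} = box a b"
    by (simp add: box_bump_nonzero_iff)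
  ultimately show ?thesis
    using assms by (simp add: test_functions_def)
qed

section \<open>Uniqueness of weak gradients\<close>

lemma UN_box_nat: "(\<Union>n::nat. box (- (real n *\<^sub>R One)) (real n *\<^sub>R One)) = (UNIV :: 'a::euclidean_space set)"
proof -
  have "\<exists>n::nat. x \<in> box (- (real n *\<^sub>R One)) (real n *\<^sub>R One)" for x :: 'a
  proof -
    obtain n :: nat where n: "norm x < real n" using reals_Archimedean2 by blast
    have "x \<in> box (- (real n *\<^sub>R One)) (real n *\<^sub>R One)"
      using Basis_le_norm[of _ x] n by (fastforce simp: mem_box abs_le_iff)
    then show ?thesis by blast
  qed
  then show ?thesis by blast
qed

text \<open>
  The sets over which \<open>g\<close> integrates to zero are closed under complements and disjoint unions, and
  boxes form an intersection-stable generator of the Borel sets.  A Lebesgue set differs from a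
  Borel set by a null set, so \<open>g\<close> integrates to zero over every measurable set.
\<close>
lemma AE_zero_if_box_integrals_zero:
  fixes g :: "'a::euclidean_space \<Rightarrow> real"
  assumes g: "integrable lebesgue g"
    and boxes: "\<And>a b. (LINT x:box a b|lebesgue. g x) = 0"
  shows "AE x in lebesgue. g x = 0"
proof (rule density_unique_real[OF g integrable_zero])
  have si: "set_integrable lebesgue A g" if "A \<in> sets lebesgue" for A
    using integrable_mult_indicator[OF that g] by (simp add: set_integrable_def)
  have whole: "(LINT x|lebesgue. g x) = 0"
  proof -
    have "(\<lambda>n. LINT x:box (- (real n *\<^sub>R One)) (real n *\<^sub>R One)|lebesgue. g x)
        \<longlonglongrightarrow> (LINT x:(\<Union>n::nat. box (- (real n *\<^sub>R One)) (real n *\<^sub>R One))|lebesgue. g x)"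
    proof (rule set_integral_cont_up)
      show "incseq (\<lambda>n::nat. box (- (real n *\<^sub>R One)) (real n *\<^sub>R One) :: 'a set)"
        by (fastforce simp: incseq_def mem_box)
    qed (auto intro!: si)
    then show ?thesis
      unfolding boxes UN_box_nat by (simp add: LIMSEQ_const_iff set_lebesgue_integral_def)
  qed
  have gen: "sigma_sets UNIV (range (\<lambda>(a, b). box a b :: 'a set)) = sets borel"
    by (simp add: borel_eq_box)
  have borel: "(LINT x:A|lebesgue. g x) = 0" if "A \<in> sets borel" for A
  proof -
    have A: "A \<in> sigma_sets UNIV (range (\<lambda>(a, b). box a b))"
      using that gen by simp
    show ?thesis
    proof (rule sigma_sets_induct_disjoint[OF _ _ A, where P = "\<lambda>A. (LINT x:A|lebesgue. g x) = 0"])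
      show "Int_stable (range (\<lambda>(a, b). box a b :: 'a set))"
        by (auto simp: Int_stable_def Int_interval box_Int_box)
    next
      fix A :: "'a set" assume "A \<in> range (\<lambda>(a, b). box a b)"
      then show "(LINT x:A|lebesgue. g x) = 0" using boxes by auto
    next
      fix A :: "'a set"
      assume A: "A \<in> sigma_sets UNIV (range (\<lambda>(a, b). box a b))" "(LINT x:A|lebesgue. g x) = 0"
      then have "A \<in> sets lebesgue" unfolding gen by simp
      then have "(LINT x:A \<union> (UNIV - A)|lebesgue. g x) =
          (LINT x:A|lebesgue. g x) + (LINT x:UNIV - A|lebesgue. g x)"
        by (intro set_integral_Un si) auto
      then show "(LINT x:UNIV - A|lebesgue. g x) = 0"
        using A whole by (simp add: set_lebesgue_integral_def)
    next
      fix A :: "nat \<Rightarrow> 'a set"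
      assume A: "disjoint_family A" "range A \<subseteq> sigma_sets UNIV (range (\<lambda>(a, b). box a b))"
        "\<And>i. (LINT x:A i|lebesgue. g x) = 0"
      then have "A i \<in> sets lebesgue" for i
        unfolding gen by auto
      then show "(LINT x:\<Union> (range A)|lebesgue. g x) = 0"
        using A by (subst lebesgue_integral_countable_add) (auto simp: disjoint_family_on_def intro!: si)
    next
      show "(LINT x:{}|lebesgue. g x) = 0" by (simp add: set_lebesgue_integral_def)
    qed simp
  qed
  show "(LINT x:A|lebesgue. g x) = (LINT x:A|lebesgue. 0)" if A: "A \<in> sets lebesgue" for A
  proof -
    have "(LINT x:A|lebesgue. g x) = (LINT x:main_part lborel A|lebesgue. g x)"
    proof (rule set_integral_null_delta)
      obtain N where "N \<in> null_sets lborel" "null_part lborel A \<subseteq> N"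
        using null_part[OF A] by blast
      moreover have "(A - main_part lborel A) \<union> (main_part lborel A - A) \<subseteq> null_part lborel A"
        using main_part_null_part_Un[OF A] by blast
      ultimately show "(A - main_part lborel A) \<union> (main_part lborel A - A) \<in> null_sets lebesgue"
        by (intro null_sets_completion_subset[OF order_trans null_sets_completionI])
    qed (use A g in auto)
    then show ?thesis using borel main_part_sets[OF A] by (simp add: set_lebesgue_integral_def)
  qed
qed

lemma locally_integrable_cmult_indicator:
  assumes "locally_integrable \<Omega> g" "compact K" "K \<subseteq> \<Omega>" "S \<subseteq> K" "S \<in> sets lebesgue"
  shows "integrable lebesgue (\<lambda>x. indicator S x *\<^sub>R g x)"
proof -
  have "set_integrable lebesgue K g"
    using assms by (simp add: locally_integrable_def)
  from set_integrable_subset[OF this] show ?thesis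
    using assms by (simp add: set_integrable_def)
qed

text \<open>
  The fundamental lemma of the calculus of variations.  Testing with the bumps of a box whose
  closure lies in \<open>\<Omega>\<close> and passing to the limit by dominated convergence shows that \<open>g\<close> integrates to
  zero over the box.  Hence \<open>g\<close> vanishes almost everywhere on every closed box inside \<open>\<Omega>\<close>, and
  countably many of those cover \<open>\<Omega>\<close>.
\<close>
lemma AE_zero_if_test_integrals_zero:
  fixes g :: "real ^ 'n \<Rightarrow> real"
  assumes \<Omega>: "open \<Omega>" and g: "locally_integrable \<Omega> g"
    and tests: "\<And>\<phi>. \<phi> \<in> test_functions \<Omega> \<Longrightarrow> (LINT x|lebesgue_on \<Omega>. g x * \<phi> x) = 0"
  shows "AE x in lebesgue_on \<Omega>. g x = 0"
proof -
  have \<Omega>_sets: "\<Omega> \<in> sets lebesgue" using \<Omega> by auto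
  have int: "integrable lebesgue (\<lambda>x. indicator (box a b) x *\<^sub>R g x)"
    if "closure (box a b) \<subseteq> \<Omega>" for a b
    using locally_integrable_cmult_indicator[OF g _ that closure_subset]
    by (auto simp: bounded_box)
  have zero: "(LINT x|lebesgue. indicator (box a b) x *\<^sub>R g x) = 0"
    if sub: "closure (box a b) \<subseteq> \<Omega>" for a b
  proof -
    have "(\<lambda>n. LINT x|lebesgue. (indicator (box a b) x *\<^sub>R g x) * box_bump a b n x)
        \<longlonglongrightarrow> (LINT x|lebesgue. (indicator (box a b) x *\<^sub>R g x) * indicator (box a b) x)"
    proof (rule integral_dominated_convergence[where w = "\<lambda>x. norm (indicator (box a b) x *\<^sub>R g x)"])
      have "continuous_on UNIV (box_bump a b n)" for n
        using box_bump_test_function[OF sub, of n] unfolding test_functions_def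
        by (metis (mono_tags, lifting) C_k.simps(1) mem_Collect_eq)
      then have "box_bump a b n \<in> borel_measurable lebesgue" for n
        by (intro measurable_completion) (simp add: borel_measurable_continuous_onI)
      then show "(\<lambda>x. (indicator (box a b) x *\<^sub>R g x) * box_bump a b n x) \<in> borel_measurable lebesgue" for n
        using borel_measurable_integrable[OF int[OF sub]] by (intro borel_measurable_times) auto
      show "(\<lambda>x. (indicator (box a b) x *\<^sub>R g x) * indicator (box a b) x) \<in> borel_measurable lebesgue"
        using borel_measurable_integrable[OF int[OF sub]]
        by (intro borel_measurable_times borel_measurable_indicator) auto
      show "AE x in lebesgue. (\<lambda>n. (indicator (box a b) x *\<^sub>R g x) * box_bump a b n x)
          \<longlonglongrightarrow> (indicator (box a b) x *\<^sub>R g x) * indicator (box a b) x"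
        by (intro AE_I2 tendsto_mult tendsto_const box_bump_tendsto)
      show "AE x in lebesgue. norm ((indicator (box a b) x *\<^sub>R g x) * box_bump a b n x)
          \<le> norm (indicator (box a b) x *\<^sub>R g x)" for n
        using box_bump_bounds[of a b n] by (auto simp: abs_mult intro!: mult_left_le)
    qed (use int[OF sub] in auto)
    moreover have "(LINT x|lebesgue. (indicator (box a b) x *\<^sub>R g x) * box_bump a b n x) = 0" for n
    proof -
      \<comment> \<open>local integrability gives measurability of \<open>g\<close> on compact sets, hence the cut-off to the box\<close>
      have "(\<lambda>x. (indicator (box a b) x *\<^sub>R g x) * box_bump a b n x) =
          (\<lambda>x. indicator \<Omega> x *\<^sub>R (g x * box_bump a b n x))"
        using box_bump_nonzero_iff[of a b n] sub closure_subset[of "box a b"]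
        by (auto simp: indicator_def fun_eq_iff)
      then show ?thesis
        using tests[OF box_bump_test_function[OF sub, of n]] \<Omega>_sets
        by (simp only: integral_restrict_space sets.Int_space_eq2)
    qed
    ultimately have "(LINT x|lebesgue. (indicator (box a b) x *\<^sub>R g x) * indicator (box a b) x) = 0"
      by (simp add: LIMSEQ_const_iff)
    moreover have "(\<lambda>x. (indicator (box a b) x *\<^sub>R g x) * indicator (box a b) x) =
        (\<lambda>x. indicator (box a b) x *\<^sub>R g x)"
      by (simp add: indicator_def fun_eq_iff)
    ultimately show ?thesis by simp
  qed
  have cbox: "AE x in lebesgue. x \<in> cbox a b \<longrightarrow> g x = 0" if "cbox a b \<subseteq> \<Omega>" for a b
  proof -
    have sub: "closure S \<subseteq> \<Omega>" if "S \<subseteq> box a b" for S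
      using closure_minimal[of S "cbox a b"] that \<open>cbox a b \<subseteq> \<Omega>\<close> box_subset_cbox[of a b] by auto
    have "AE x in lebesgue. indicator (box a b) x *\<^sub>R g x = 0"
    proof (rule AE_zero_if_box_integrals_zero[OF int[OF sub[OF order_refl]]])
      fix c d
      obtain c' d' where cd: "box c d \<inter> box a b = box c' d'"
        by (simp add: box_Int_box)
      have "(LINT x:box c d|lebesgue. indicator (box a b) x *\<^sub>R g x) =
          (LINT x|lebesgue. indicator (box c' d') x *\<^sub>R g x)"
        by (simp add: set_lebesgue_integral_def cd[symmetric] indicator_inter_arith mult.assoc)
      also have "\<dots> = 0" by (rule zero, rule sub) (use cd in blast)
      finally show "(LINT x:box c d|lebesgue. indicator (box a b) x *\<^sub>R g x) = 0" .
    qed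
    moreover have "AE x in lebesgue. x \<notin> cbox a b - box a b"
      using negligible_frontier_interval[of a b] by (intro AE_not_in) (simp add: negligible_iff_null_sets)
    ultimately show ?thesis
      by eventually_elim (auto simp: indicator_def)
  qed
  obtain D where D: "countable D" "D \<subseteq> Pow \<Omega>" "\<And>X. X \<in> D \<Longrightarrow> \<exists>a b. X = cbox a b" "\<Union>D = \<Omega>"
    using open_countable_Union_open_cbox[OF \<Omega>] by metis
  have "AE x in lebesgue. \<forall>X\<in>D. x \<in> X \<longrightarrow> g x = 0"
    unfolding AE_ball_countable[OF D(1)] using D cbox by (metis PowD subsetD)
  then have "AE x in lebesgue. x \<in> \<Omega> \<longrightarrow> g x = 0"
    by eventually_elim (use D(4) in auto)
  then show ?thesis
    using \<Omega>_sets by (simp add: AE_restrict_space_iff)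
qed

lemma test_function_continuous:
  assumes "\<phi> \<in> test_functions \<Omega>"
  shows "continuous_on UNIV \<phi>" "continuous_on UNIV (partial_deriv i \<phi>)"
proof -
  have "C_k 0 \<phi>" "C_k (Suc 0) \<phi>" using assms by (auto simp: test_functions_def simp del: C_k.simps)
  then show "continuous_on UNIV \<phi>" "continuous_on UNIV (partial_deriv i \<phi>)" by auto
qed

lemma partial_deriv_eq_0_outside_support:
  assumes "x \<notin> closure {x. \<phi> x \<noteq> 0}"
  shows "partial_deriv i \<phi> x = 0"
proof -
  have "(\<phi> has_derivative (\<lambda>_. 0)) (at x)"
    by (rule has_derivative_transform_within_open[OF has_derivative_const[of 0], of "- closure {x. \<phi> x \<noteq> 0}"])
       (use assms closure_subset[of "{x. \<phi> x \<noteq> 0}"] in auto)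
  then show ?thesis
    by (simp add: partial_deriv_def frechet_derivative_at[symmetric])
qed

lemma integrable_mult_compact_support:
  fixes g \<psi> :: "real ^ 'n \<Rightarrow> real"
  assumes \<Omega>: "open \<Omega>" and g: "locally_integrable \<Omega> g"
    and K: "compact K" "K \<subseteq> \<Omega>" and \<psi>: "continuous_on UNIV \<psi>" "\<And>x. x \<notin> K \<Longrightarrow> \<psi> x = 0"
  shows "integrable (lebesgue_on \<Omega>) (\<lambda>x. g x * \<psi> x)"
proof -
  have gK: "integrable lebesgue (\<lambda>x. indicator K x *\<^sub>R g x)"
    using locally_integrable_cmult_indicator[OF g K order_refl] K by (simp add: compact_imp_closed)
  have "bounded (\<psi> ` K)"
    using K \<psi> by (meson compact_continuous_image compact_imp_bounded continuous_on_subset subset_UNIV)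
  then obtain C where C: "\<And>x. x \<in> K \<Longrightarrow> \<bar>\<psi> x\<bar> \<le> C" by (auto simp: bounded_iff)
  have "\<psi> \<in> borel_measurable lebesgue"
    using \<psi>(1) by (intro measurable_completion) (simp add: borel_measurable_continuous_onI)
  then have "integrable lebesgue (\<lambda>x. (indicator K x *\<^sub>R g x) * \<psi> x)"
    by (intro Bochner_Integration.integrable_bound[OF integrable_mult_right[OF gK, of C]])
       (use borel_measurable_integrable[OF gK] C in \<open>auto simp: indicator_def abs_mult intro!: AE_I2\<close>,
        metis abs_ge_self abs_ge_zero mult.commute mult_right_mono order_trans)
  moreover have "(\<lambda>x. (indicator K x *\<^sub>R g x) * \<psi> x) = (\<lambda>x. indicator \<Omega> x *\<^sub>R (g x * \<psi> x))"
    using K \<psi>(2) by (auto simp: indicator_def fun_eq_iff)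
  ultimately have "integrable lebesgue (\<lambda>x. indicator \<Omega> x *\<^sub>R (g x * \<psi> x))"
    by simp
  then show ?thesis
    using \<Omega> by (subst integrable_restrict_space) auto
qed

lemma integrable_mult_test_function:
  assumes "open \<Omega>" "locally_integrable \<Omega> g" "\<phi> \<in> test_functions \<Omega>"
  shows "integrable (lebesgue_on \<Omega>) (\<lambda>x. g x * \<phi> x)"
    and "integrable (lebesgue_on \<Omega>) (\<lambda>x. g x * partial_deriv i \<phi> x)"
proof -
  let ?K = "closure {x. \<phi> x \<noteq> 0}"
  have K: "compact ?K" "?K \<subseteq> \<Omega>" using assms(3) by (auto simp: test_functions_def)
  show "integrable (lebesgue_on \<Omega>) (\<lambda>x. g x * \<phi> x)"
    using closure_subset[of "{x. \<phi> x \<noteq> 0}"]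
    by (intro integrable_mult_compact_support[OF assms(1,2) K] test_function_continuous[OF assms(3)]) auto
  show "integrable (lebesgue_on \<Omega>) (\<lambda>x. g x * partial_deriv i \<phi> x)"
    by (intro integrable_mult_compact_support[OF assms(1,2) K] test_function_continuous[OF assms(3)]
        partial_deriv_eq_0_outside_support)
qed

lemma locally_integrable_diff:
  "locally_integrable \<Omega> g \<Longrightarrow> locally_integrable \<Omega> h \<Longrightarrow> locally_integrable \<Omega> (\<lambda>x. g x - h x)"
  by (auto simp: locally_integrable_def)

lemma locally_integrable_component:
  fixes G :: "real ^ 'n \<Rightarrow> real ^ 'n"
  assumes "locally_integrable \<Omega> G"
  shows "locally_integrable \<Omega> (\<lambda>x. G x $ i)"
  unfolding locally_integrable_def
proof (intro allI impI)
  fix K assume "compact K \<and> K \<subseteq> \<Omega>"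
  then have "set_integrable lebesgue K G" using assms by (simp add: locally_integrable_def)
  from integrable_bounded_linear[OF bounded_linear_vec_nth[of i] this[unfolded set_integrable_def]]
  show "set_integrable lebesgue K (\<lambda>x. G x $ i)" by (simp add: set_integrable_def)
qed

text \<open>
  Bochner integrals are additive only on integrable functions; the compact support of the test
  function inside \<open>\<Omega>\<close> turns local integrability into integrability of each product.
\<close>
lemma is_weak_gradient_diff:
  assumes \<Omega>: "open \<Omega>" and g: "is_weak_gradient \<Omega> g G" and h: "is_weak_gradient \<Omega> h H"
  shows "is_weak_gradient \<Omega> (\<lambda>x. g x - h x) (\<lambda>x. G x - H x)"
  unfolding is_weak_gradient_def
proof (intro conjI ballI allI)
  have loc: "locally_integrable \<Omega> g" "locally_integrable \<Omega> h" "locally_integrable \<Omega> G" "locally_integrable \<Omega> H"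
    using g h by (auto simp: is_weak_gradient_def)
  then show "locally_integrable \<Omega> (\<lambda>x. g x - h x)" "locally_integrable \<Omega> (\<lambda>x. G x - H x)"
    by (auto intro: locally_integrable_diff)
  fix \<phi> i assume \<phi>: "\<phi> \<in> test_functions \<Omega>"
  then have "(LINT x|lebesgue_on \<Omega>. g x * partial_deriv i \<phi> x) = - (LINT x|lebesgue_on \<Omega>. (G x $ i) * \<phi> x)"
    "(LINT x|lebesgue_on \<Omega>. h x * partial_deriv i \<phi> x) = - (LINT x|lebesgue_on \<Omega>. (H x $ i) * \<phi> x)"
    using g h by (auto simp: is_weak_gradient_def)
  then show "(LINT x|lebesgue_on \<Omega>. (g x - h x) * partial_deriv i \<phi> x) =
      - (LINT x|lebesgue_on \<Omega>. ((G x - H x) $ i) * \<phi> x)"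
    using loc \<phi> by (simp add: left_diff_distrib Bochner_Integration.integral_diff
        integrable_mult_test_function[OF \<Omega>] locally_integrable_component)
qed

lemma is_weak_gradient_unique:
  assumes \<Omega>: "open \<Omega>" and G: "is_weak_gradient \<Omega> g G" and H: "is_weak_gradient \<Omega> g H"
  shows "AE x in lebesgue_on \<Omega>. G x = H x"
proof -
  have loc: "locally_integrable \<Omega> G" "locally_integrable \<Omega> H"
    using G H by (auto simp: is_weak_gradient_def)
  have "AE x in lebesgue_on \<Omega>. G x $ i - H x $ i = 0" for i
  proof (rule AE_zero_if_test_integrals_zero[OF \<Omega>])
    show "locally_integrable \<Omega> (\<lambda>x. G x $ i - H x $ i)"
      by (intro locally_integrable_diff locally_integrable_component loc)
    fix \<phi> assume \<phi>: "\<phi> \<in> test_functions \<Omega>"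
    have "- (LINT x|lebesgue_on \<Omega>. (G x $ i) * \<phi> x) = (LINT x|lebesgue_on \<Omega>. g x * partial_deriv i \<phi> x)"
      using G \<phi> by (simp add: is_weak_gradient_def)
    also have "\<dots> = - (LINT x|lebesgue_on \<Omega>. (H x $ i) * \<phi> x)"
      using H \<phi> by (simp add: is_weak_gradient_def)
    finally show "(LINT x|lebesgue_on \<Omega>. (G x $ i - H x $ i) * \<phi> x) = 0"
      using loc \<phi> by (simp add: left_diff_distrib Bochner_Integration.integral_diff
          integrable_mult_test_function[OF \<Omega>] locally_integrable_component)
  qed
  then have "AE x in lebesgue_on \<Omega>. \<forall>i. G x $ i - H x $ i = 0"
    by (subst AE_all_countable) auto
  then show ?thesis
    by eventually_elim (simp add: vec_eq_iff)
qed

lemma is_weak_gradient_wgrad: "weakly_differentiable \<Omega> g \<Longrightarrow> is_weak_gradient \<Omega> g (wgrad \<Omega> g)"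
  unfolding weakly_differentiable_def wgrad_def by (erule someI_ex)

text \<open>
  The representatives chosen by \<^const>\<open>wgrad\<close> are unrelated for different arguments; uniqueness
  makes the choice compatible with subtraction up to null sets.
\<close>
lemma wgrad_diff:
  assumes "open \<Omega>" "weakly_differentiable \<Omega> g" "weakly_differentiable \<Omega> h"
  shows "AE x in lebesgue_on \<Omega>. wgrad \<Omega> (\<lambda>x. g x - h x) x = wgrad \<Omega> g x - wgrad \<Omega> h x"
proof -
  have "is_weak_gradient \<Omega> (\<lambda>x. g x - h x) (\<lambda>x. wgrad \<Omega> g x - wgrad \<Omega> h x)"
    by (intro is_weak_gradient_diff is_weak_gradient_wgrad assms)
  then show ?thesis
    using is_weak_gradient_unique[OF assms(1) is_weak_gradient_wgrad]
    by (auto simp: weakly_differentiable_def)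
qed

section \<open>Pointwise estimates for the energy density\<close>

text \<open>
  Young's inequality for the conjugate exponents \<open>p / (p - 1)\<close> and \<open>p\<close>.
\<close>
lemma powr_minus_1_mult_le:
  fixes a b p :: real
  assumes "1 < p" "0 \<le> a" "0 \<le> b"
  shows "a powr (p - 1) * b \<le> (1 - 1 / p) * a powr p + 1 / p * b powr p"
proof -
  let ?q = "p / (p - 1)"
  have q: "?q > 1" "1 / ?q + 1 / p = 1" using assms by (auto simp: field_simps)
  have "(a powr (p - 1)) powr ?q = a powr p" using assms by (simp add: powr_powr)
  moreover have "1 / ?q = 1 - 1 / p" using q by simp
  ultimately show ?thesis
    using Youngs_inequality[OF q(1) assms(1) q(2), of "a powr (p - 1)" b] assms
    by (metis divide_inverse mult.commute mult_1 powr_ge_zero)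
qed

lemma abs_flux_inner_le:
  fixes \<xi> \<eta> :: "'a::real_inner"
  shows "\<bar>(norm \<xi> powr (p - 2) *\<^sub>R \<xi>) \<bullet> \<eta>\<bar> \<le> norm \<xi> powr (p - 1) * norm \<eta>"
proof -
  have "\<bar>(norm \<xi> powr (p - 2) *\<^sub>R \<xi>) \<bullet> \<eta>\<bar> \<le> norm \<xi> powr (p - 2) * norm \<xi> * norm \<eta>"
    using Cauchy_Schwarz_ineq2[of "norm \<xi> powr (p - 2) *\<^sub>R \<xi>" \<eta>] by simp
  also have "norm \<xi> powr (p - 2) * norm \<xi> = norm \<xi> powr (p - 1)"
    using powr_mult_base[of "norm \<xi>" "p - 2"] by (cases "\<xi> = 0") (auto simp: mult.commute)
  finally show ?thesis .
qed

lemma flux_inner_self: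
  fixes \<xi> :: "'a::real_inner"
  shows "(norm \<xi> powr (p - 2) *\<^sub>R \<xi>) \<bullet> \<xi> = norm \<xi> powr p"
proof (cases "\<xi> = 0")
  case False
  have "norm \<xi> powr (p - 2) * (norm \<xi> powr 2) = norm \<xi> powr p"
    unfolding powr_add[symmetric] by simp
  then show ?thesis using False by (simp add: dot_square_norm powr_numeral)
qed simp

text \<open>
  Convexity of \<open>|\<xi>|\<^sup>p / p\<close>: its tangent at \<open>\<xi>\<close> lies below its graph.  As \<open>a(\<xi>) \<bullet> \<xi> = |\<xi>|\<^sup>p\<close>, this
  is Cauchy--Schwarz followed by Young's inequality for \<open>a(\<xi>) \<bullet> \<eta>\<close>.
\<close>
lemma powr_norm_subgradient:
  fixes \<xi> \<eta> :: "'a::real_inner"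
  assumes "1 < p"
  shows "1 / p * norm \<xi> powr p + (norm \<xi> powr (p - 2) *\<^sub>R \<xi>) \<bullet> \<eta> - (norm \<xi> powr (p - 2) *\<^sub>R \<xi>) \<bullet> \<xi>
    \<le> 1 / p * norm \<eta> powr p"
proof -
  have "(norm \<xi> powr (p - 2) *\<^sub>R \<xi>) \<bullet> \<eta> \<le> (1 - 1 / p) * norm \<xi> powr p + 1 / p * norm \<eta> powr p"
    using abs_flux_inner_le[of \<xi> p \<eta>] powr_minus_1_mult_le[OF assms norm_ge_zero[of \<xi>] norm_ge_zero[of \<eta>]]
    by linarith
  then show ?thesis
    unfolding flux_inner_self left_diff_distrib by linarith
qed

text \<open>
  With \<open>h = |\<eta> - \<xi>|\<close>, the left side is at most \<open>(|\<xi>| + h)\<^sup>p - |\<xi>|\<^sup>p + |\<xi>|\<^sup>p\<^sup>-\<^sup>1 h\<close>.  Where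
  \<open>h \<le> \<epsilon> |\<xi>|\<close> this is a small multiple of \<open>|\<xi>|\<^sup>p\<close>; elsewhere \<open>|\<xi>| < h / \<epsilon>\<close> and it is a large multiple
  of \<open>h\<^sup>p\<close>.  The constants depend on the bound \<open>M\<close> of the exponent and not on \<open>p\<close>, so that the
  estimate can be integrated when the exponent varies in space.
\<close>
lemma powr_norm_excess:
  fixes \<xi> \<eta> :: "'a::real_inner"
  assumes p: "1 < p" "p \<le> M" and \<epsilon>: "0 < \<epsilon>" "\<epsilon> \<le> 1"
  shows "1 / p * norm \<eta> powr p - 1 / p * norm \<xi> powr p - ((norm \<xi> powr (p - 2) *\<^sub>R \<xi>) \<bullet> \<eta> - (norm \<xi> powr (p - 2) *\<^sub>R \<xi>) \<bullet> \<xi>)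
    \<le> ((1 + \<epsilon>) powr M - 1 + \<epsilon>) * norm \<xi> powr p + ((1 + 1 / \<epsilon>) powr M + \<epsilon> powr (1 - M)) * norm (\<eta> - \<xi>) powr p"
    (is "?lhs \<le> ?A * _ + ?B * _")
proof -
  define a h where "a = norm \<xi>" and "h = norm (\<eta> - \<xi>)"
  have ah: "0 \<le> a" "0 \<le> h" by (auto simp: a_def h_def)
  have eta: "norm \<eta> \<le> a + h"
    using norm_triangle_ineq[of \<xi> "\<eta> - \<xi>"] by (simp add: a_def h_def)
  have fl: "- ((norm \<xi> powr (p - 2) *\<^sub>R \<xi>) \<bullet> \<eta> - (norm \<xi> powr (p - 2) *\<^sub>R \<xi>) \<bullet> \<xi>) \<le> a powr (p - 1) * h"
    using abs_flux_inner_le[of \<xi> p "\<eta> - \<xi>"] unfolding a_def h_def inner_diff_right by linarith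
  have AB: "(1 + \<epsilon>) powr M \<ge> 1" "(1 + 1 / \<epsilon>) powr M \<ge> 0" "\<epsilon> powr (1 - M) \<ge> 0"
    using p \<epsilon> by (auto intro!: ge_one_powr_ge_zero)
  have sq: "norm \<eta> powr p \<le> (a + h) powr p"
    using eta p by (intro powr_mono2) auto
  have main: "(a + h) powr p - a powr p + a powr (p - 1) * h \<le> ?A * a powr p + ?B * h powr p"
  proof (cases "h \<le> \<epsilon> * a")
    case True
    have "(a + h) powr p \<le> ((1 + \<epsilon>) * a) powr p"
      using True ah p by (intro powr_mono2) (auto simp: algebra_simps)
    also have "\<dots> = (1 + \<epsilon>) powr p * a powr p" using ah \<epsilon> by (simp add: powr_mult)
    also have "\<dots> \<le> (1 + \<epsilon>) powr M * a powr p"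
      using p \<epsilon> by (intro mult_right_mono powr_mono) auto
    finally have 1: "(a + h) powr p \<le> (1 + \<epsilon>) powr M * a powr p" .
    have "a powr (p - 1) * h \<le> a powr (p - 1) * (\<epsilon> * a)"
      using True by (intro mult_left_mono) auto
    also have "\<dots> = \<epsilon> * a powr p"
      using powr_mult_base[OF ah(1), of "p - 1"] by (simp add: mult_ac)
    finally have 2: "a powr (p - 1) * h \<le> \<epsilon> * a powr p" .
    have "0 \<le> ?B * h powr p" using AB by simp
    then show ?thesis using 1 2 unfolding distrib_right left_diff_distrib by linarith
  next
    case False
    then have a_le: "a \<le> h / \<epsilon>" using \<epsilon> by (simp add: field_simps)
    have "(a + h) powr p \<le> ((1 + 1 / \<epsilon>) * h) powr p"
      using a_le ah p by (intro powr_mono2) (auto simp: algebra_simps)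
    also have "\<dots> = (1 + 1 / \<epsilon>) powr p * h powr p" using ah \<epsilon> by (simp add: powr_mult)
    also have "\<dots> \<le> (1 + 1 / \<epsilon>) powr M * h powr p"
      using p \<epsilon> by (intro mult_right_mono powr_mono) auto
    finally have 1: "(a + h) powr p \<le> (1 + 1 / \<epsilon>) powr M * h powr p" .
    have "a powr (p - 1) * h \<le> (h / \<epsilon>) powr (p - 1) * h"
      using a_le ah p by (intro mult_right_mono powr_mono2) auto
    also have "\<dots> = \<epsilon> powr (1 - p) * h powr p"
    proof -
      have "(h / \<epsilon>) powr (p - 1) = \<epsilon> powr (1 - p) * h powr (p - 1)"
        using ah \<epsilon> powr_minus_divide[of \<epsilon> "p - 1"] by (simp add: powr_divide)
      then show ?thesis
        using powr_mult_base[OF ah(2), of "p - 1"] by (simp add: mult.commute)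
    qed
    also have "\<dots> \<le> \<epsilon> powr (1 - M) * h powr p"
      using p \<epsilon> by (intro mult_right_mono powr_mono') auto
    finally have 2: "a powr (p - 1) * h \<le> \<epsilon> powr (1 - M) * h powr p" .
    have "0 \<le> ((1 + \<epsilon>) powr M - 1 + \<epsilon>) * a powr p" using AB \<epsilon> by simp
    moreover have "0 \<le> a powr p" by simp
    ultimately show ?thesis using 1 2 unfolding distrib_right by linarith
  qed
  have "a powr p \<le> (a + h) powr p" using ah p by (intro powr_mono2) auto
  then have "1 / p * ((a + h) powr p - a powr p) \<le> (a + h) powr p - a powr p"
    using p by (intro mult_left_le_one_le) auto
  moreover have "1 / p * norm \<eta> powr p \<le> 1 / p * (a + h) powr p"
    using sq p by (intro mult_left_mono) auto
  ultimately have "1 / p * norm \<eta> powr p - 1 / p * a powr p \<le> (a + h) powr p - a powr p"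
    unfolding right_diff_distrib by linarith
  then show ?thesis using fl main unfolding a_def h_def by linarith
qed

section \<open>Variable exponent Lebesgue spaces\<close>

lemma C_plus_bounds:
  assumes "bounded \<Omega>" "p \<in> C_plus \<Omega>"
  shows "\<exists>M. \<forall>x\<in>\<Omega>. 1 < p x \<and> p x \<le> M"
proof -
  have p: "continuous_on (closure \<Omega>) p" "(INF x\<in>closure \<Omega>. p x) > 1"
    using assms(2) by (auto simp: C_plus_def)
  have "bounded (p ` closure \<Omega>)"
    using assms(1) p(1) by (intro compact_imp_bounded compact_continuous_image) auto
  then have "bdd_above (p ` closure \<Omega>)" "bdd_below (p ` closure \<Omega>)"
    by (auto intro: bounded_imp_bdd_above bounded_imp_bdd_below)
  then obtain M where "\<And>x. x \<in> closure \<Omega> \<Longrightarrow> p x \<le> M"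
    and "\<And>x. x \<in> closure \<Omega> \<Longrightarrow> (INF x\<in>closure \<Omega>. p x) \<le> p x"
    by (metis bdd_above.E cINF_lower imageI)
  then show ?thesis
    using p(2) closure_subset[of \<Omega>] by (intro exI[of _ M]) (auto intro: less_le_trans)
qed

lemma C_plus_measurable:
  assumes "open \<Omega>" "p \<in> C_plus \<Omega>"
  shows "p \<in> borel_measurable (lebesgue_on \<Omega>)"
  using assms continuous_on_subset[OF _ closure_subset]
  by (auto simp: C_plus_def intro!: continuous_imp_measurable_on_sets_lebesgue)

lemma Lvar_integrable_powr:
  assumes "p \<in> borel_measurable (lebesgue_on \<Omega>)" "G \<in> Lvar \<Omega> p"
  shows "integrable (lebesgue_on \<Omega>) (\<lambda>x. norm (G x) powr p x)"
  using assms by (intro integrableI_nonneg) (auto simp: Lvar_def modular_def)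

lemma integrable_energy_density:
  assumes "p \<in> borel_measurable (lebesgue_on \<Omega>)" "\<And>x. x \<in> \<Omega> \<Longrightarrow> 1 < p x" "G \<in> Lvar \<Omega> p"
  shows "integrable (lebesgue_on \<Omega>) (\<lambda>x. 1 / p x * norm (G x) powr p x)"
proof (rule Bochner_Integration.integrable_bound[OF Lvar_integrable_powr[OF assms(1,3)]])
  have [measurable]: "p \<in> borel_measurable (lebesgue_on \<Omega>)" "G \<in> borel_measurable (lebesgue_on \<Omega>)"
    using assms by (auto simp: Lvar_def)
  show "(\<lambda>x. 1 / p x * norm (G x) powr p x) \<in> borel_measurable (lebesgue_on \<Omega>)" by measurable
  show "AE x in lebesgue_on \<Omega>. norm (1 / p x * norm (G x) powr p x) \<le> norm (norm (G x) powr p x)"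
  proof (rule AE_I2)
    fix x assume "x \<in> space (lebesgue_on \<Omega>)"
    then have "1 < p x" using assms(2) by simp
    then show "norm (1 / p x * norm (G x) powr p x) \<le> norm (norm (G x) powr p x)"
      using mult_left_le_one_le[of "norm (G x) powr p x" "1 / p x"] by simp
  qed
qed

lemma integrable_flux_inner:
  fixes G H :: "real ^ 'n \<Rightarrow> real ^ 'n"
  assumes "p \<in> borel_measurable (lebesgue_on \<Omega>)" "\<And>x. x \<in> \<Omega> \<Longrightarrow> 1 < p x"
    and "G \<in> Lvar \<Omega> p" "H \<in> Lvar \<Omega> p"
  shows "integrable (lebesgue_on \<Omega>) (\<lambda>x. (norm (G x) powr (p x - 2) *\<^sub>R G x) \<bullet> H x)"
proof (rule Bochner_Integration.integrable_bound)
  have [measurable]: "p \<in> borel_measurable (lebesgue_on \<Omega>)" "G \<in> borel_measurable (lebesgue_on \<Omega>)"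
      "H \<in> borel_measurable (lebesgue_on \<Omega>)"
    using assms by (auto simp: Lvar_def)
  show "integrable (lebesgue_on \<Omega>) (\<lambda>x. norm (G x) powr p x + norm (H x) powr p x)"
    using assms by (intro Bochner_Integration.integrable_add Lvar_integrable_powr)
  show "(\<lambda>x. (norm (G x) powr (p x - 2) *\<^sub>R G x) \<bullet> H x) \<in> borel_measurable (lebesgue_on \<Omega>)" by measurable
  show "AE x in lebesgue_on \<Omega>. norm ((norm (G x) powr (p x - 2) *\<^sub>R G x) \<bullet> H x)
      \<le> norm (norm (G x) powr p x + norm (H x) powr p x)"
  proof (rule AE_I2)
    fix x assume "x \<in> space (lebesgue_on \<Omega>)"
    then have p: "1 < p x" using assms(2) by simp
    have "(1 - 1 / p x) * norm (G x) powr p x \<le> norm (G x) powr p x"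
      "1 / p x * norm (H x) powr p x \<le> norm (H x) powr p x"
      by (rule mult_left_le_one_le; use p in simp)+
    then show "norm ((norm (G x) powr (p x - 2) *\<^sub>R G x) \<bullet> H x)
      \<le> norm (norm (G x) powr p x + norm (H x) powr p x)"
      using abs_flux_inner_le[of "G x" "p x" "H x"]
        powr_minus_1_mult_le[OF p norm_ge_zero[of "G x"] norm_ge_zero[of "H x"]]
      unfolding real_norm_def by linarith
  qed
qed

lemma Lvar_diff:
  assumes p: "p \<in> borel_measurable (lebesgue_on \<Omega>)" "\<And>x. x \<in> \<Omega> \<Longrightarrow> 1 < p x" "\<And>x. x \<in> \<Omega> \<Longrightarrow> p x \<le> M"
    and G: "G \<in> Lvar \<Omega> p" and H: "H \<in> Lvar \<Omega> p"
  shows "(\<lambda>x. G x - H x :: real ^ 'n) \<in> Lvar \<Omega> p"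
proof -
  have [measurable]: "p \<in> borel_measurable (lebesgue_on \<Omega>)" "G \<in> borel_measurable (lebesgue_on \<Omega>)"
      "H \<in> borel_measurable (lebesgue_on \<Omega>)"
    using assms by (auto simp: Lvar_def)
  have bound: "norm (G x - H x) powr p x \<le> 2 powr M * (norm (G x) powr p x + norm (H x) powr p x)"
    if "x \<in> \<Omega>" for x
  proof -
    let ?m = "max (norm (G x)) (norm (H x))"
    have "norm (G x - H x) \<le> 2 * ?m"
      using norm_triangle_ineq4[of "G x" "H x"] by linarith
    then have "norm (G x - H x) powr p x \<le> (2 * ?m) powr p x"
      using p(2)[OF that] by (intro powr_mono2) auto
    also have "\<dots> = 2 powr p x * ?m powr p x"
      by (simp add: powr_mult)
    also have "\<dots> \<le> 2 powr M * (norm (G x) powr p x + norm (H x) powr p x)"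
      using p(3)[OF that] by (intro mult_mono powr_mono) (auto simp: max_def)
    finally show ?thesis .
  qed
  have "integrable (lebesgue_on \<Omega>) (\<lambda>x. norm (G x - H x) powr p x)"
  proof (rule Bochner_Integration.integrable_bound)
    show "integrable (lebesgue_on \<Omega>) (\<lambda>x. 2 powr M * (norm (G x) powr p x + norm (H x) powr p x))"
      using p G H by (intro integrable_mult_right Bochner_Integration.integrable_add Lvar_integrable_powr)
    show "AE x in lebesgue_on \<Omega>. norm (norm (G x - H x) powr p x)
        \<le> norm (2 powr M * (norm (G x) powr p x + norm (H x) powr p x))"
      using bound by (intro AE_I2) auto
  qed measurable
  then show ?thesis
    by (simp add: Lvar_def modular_def nn_integral_eq_integral)
qed

text \<open>
  Exponents above \<open>1\<close> give \<open>s\<^sup>p \<le> s\<close> for \<open>s \<le> 1\<close>.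
\<close>
lemma modular_scaleR_le:
  assumes p: "\<And>x. x \<in> \<Omega> \<Longrightarrow> 1 < p x" and s: "0 \<le> s" "s \<le> 1"
    and [measurable]: "p \<in> borel_measurable (lebesgue_on \<Omega>)" "g \<in> borel_measurable (lebesgue_on \<Omega>)"
  shows "modular \<Omega> p (\<lambda>x. s *\<^sub>R g x) \<le> ennreal s * modular \<Omega> p g"
proof -
  have "norm (s *\<^sub>R g x) powr p x \<le> s * norm (g x) powr p x" if "x \<in> \<Omega>" for x
  proof -
    have "norm (s *\<^sub>R g x) powr p x = s powr p x * norm (g x) powr p x"
      using s by (simp add: powr_mult)
    also have "\<dots> \<le> s powr 1 * norm (g x) powr p x"
      using p[OF that] s by (intro mult_right_mono powr_mono') auto
    finally show ?thesis using s by simp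
  qed
  then have "modular \<Omega> p (\<lambda>x. s *\<^sub>R g x) \<le> (\<integral>\<^sup>+ x. ennreal s * ennreal (norm (g x) powr p x) \<partial>lebesgue_on \<Omega>)"
    unfolding modular_def using s by (intro nn_integral_mono) (auto simp flip: ennreal_mult intro!: ennreal_leI)
  then show ?thesis by (simp add: modular_def nn_integral_cmult)
qed

lemma Lvar_norm_cong_AE:
  assumes "AE x in lebesgue_on \<Omega>. g x = h x"
  shows "Lvar_norm \<Omega> p g = Lvar_norm \<Omega> p h"
proof -
  have "modular \<Omega> p (\<lambda>x. g x /\<^sub>R l) = modular \<Omega> p (\<lambda>x. h x /\<^sub>R l)" for l
    unfolding modular_def by (rule nn_integral_cong_AE) (use assms in eventually_elim, simp)
  then show ?thesis by (simp add: Lvar_norm_def)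
qed

text \<open>
  Scaling by an \<open>l < \<delta> \<le> 1\<close> that is admissible in the Luxemburg norm bounds the modular by \<open>l\<close>.  Such
  an \<open>l\<close> exists only if the set of admissible numbers is nonempty, because the infimum of the empty
  set of reals is arbitrary; finiteness of the modular provides the element \<open>max 1 ?I\<close>.
\<close>
lemma integral_powr_less_if_Lvar_norm_less:
  assumes p: "p \<in> borel_measurable (lebesgue_on \<Omega>)" "\<And>x. x \<in> \<Omega> \<Longrightarrow> 1 < p x"
    and g: "g \<in> Lvar \<Omega> p" and \<delta>: "Lvar_norm \<Omega> p g < \<delta>" "\<delta> \<le> 1"
  shows "(LINT x|lebesgue_on \<Omega>. norm (g x) powr p x) < \<delta>"
proof -
  let ?I = "LINT x|lebesgue_on \<Omega>. norm (g x) powr p x"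
  let ?S = "{l. l > 0 \<and> modular \<Omega> p (\<lambda>x. g x /\<^sub>R l) \<le> 1}"
  have gm: "g \<in> borel_measurable (lebesgue_on \<Omega>)" using g by (simp add: Lvar_def)
  have I: "modular \<Omega> p g = ennreal ?I"
    unfolding modular_def by (rule nn_integral_eq_integral) (use Lvar_integrable_powr[OF p(1) g] in auto)
  have I0: "0 \<le> ?I" by simp
  have "max 1 ?I \<in> ?S"
  proof -
    have "modular \<Omega> p (\<lambda>x. g x /\<^sub>R max 1 ?I) \<le> ennreal (inverse (max 1 ?I)) * ennreal ?I"
      unfolding I[symmetric] by (rule modular_scaleR_le[OF p(2) _ _ p(1) gm]) (auto simp: inverse_le_1_iff)
    also have "\<dots> = ennreal (inverse (max 1 ?I) * ?I)"
      using I0 by (simp add: ennreal_mult)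
    also have "\<dots> \<le> 1"
      using I0 by (auto simp: max_def field_simps)
    finally show ?thesis by (simp add: less_max_iff_disj)
  qed
  then obtain l where l: "l \<in> ?S" "l < \<delta>"
    using cInf_lessD[of ?S \<delta>] \<delta>(1) unfolding Lvar_norm_def by blast
  have "ennreal ?I = modular \<Omega> p (\<lambda>x. l *\<^sub>R (g x /\<^sub>R l))"
    using l I by simp
  also have "\<dots> \<le> ennreal l * modular \<Omega> p (\<lambda>x. g x /\<^sub>R l)"
    using l \<delta>(2) gm by (intro modular_scaleR_le p) auto
  also have "\<dots> \<le> ennreal l * 1"
    using l by (intro mult_left_mono) auto
  finally have "?I \<le> l" using l by simp
  then show ?thesis using l(2) by simp
qed

section \<open>Energies of weak solutions\<close>

text \<open>
  The weak equation tested with \<open>v\<close> replaces the source term by the flux of \<open>u\<close>.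
\<close>
lemma energy_solution_eq:
  assumes "solves_weakly \<Omega> p f V u" "v \<in> V"
  shows "energy \<Omega> p f v = (LINT x|lebesgue_on \<Omega>. 1 / p x * norm (wgrad \<Omega> v x) powr p x) -
    (LINT x|lebesgue_on \<Omega>. (norm (wgrad \<Omega> u x) powr (p x - 2) *\<^sub>R wgrad \<Omega> u x) \<bullet> wgrad \<Omega> v x)"
  using assms by (simp add: solves_weakly_def energy_def)

text \<open>
  The energy difference is the integral of the nonnegative Bregman distance between the two
  gradients.  An abstract \<open>V\<close> lets one argument serve the full Sobolev space and its
  finite-dimensional subspaces.
\<close>
lemma energy_solution_le:
  assumes p: "p \<in> borel_measurable (lebesgue_on \<Omega>)" "\<And>x. x \<in> \<Omega> \<Longrightarrow> 1 < p x"
    and V: "\<And>v. v \<in> V \<Longrightarrow> wgrad \<Omega> v \<in> Lvar \<Omega> p"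
    and u: "solves_weakly \<Omega> p f V u" and v: "v \<in> V"
  shows "energy \<Omega> p f u \<le> energy \<Omega> p f v"
proof -
  have uV: "u \<in> V" using u by (simp add: solves_weakly_def)
  note int = integrable_energy_density[OF p V[OF uV]] integrable_energy_density[OF p V[OF v]]
    integrable_flux_inner[OF p V[OF uV] V[OF uV]] integrable_flux_inner[OF p V[OF uV] V[OF v]]
  let ?a = "\<lambda>x. norm (wgrad \<Omega> u x) powr (p x - 2) *\<^sub>R wgrad \<Omega> u x"
  have "(LINT x|lebesgue_on \<Omega>. 1 / p x * norm (wgrad \<Omega> u x) powr p x + ?a x \<bullet> wgrad \<Omega> v x - ?a x \<bullet> wgrad \<Omega> u x)
      \<le> (LINT x|lebesgue_on \<Omega>. 1 / p x * norm (wgrad \<Omega> v x) powr p x)"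
    using int powr_norm_subgradient[OF p(2)] by (intro integral_mono) auto
  then show ?thesis
    unfolding energy_solution_eq[OF u uV] energy_solution_eq[OF u v] using int by simp
qed

lemma energy_excess_le:
  assumes p: "p \<in> borel_measurable (lebesgue_on \<Omega>)" "\<And>x. x \<in> \<Omega> \<Longrightarrow> 1 < p x" "\<And>x. x \<in> \<Omega> \<Longrightarrow> p x \<le> M"
    and V: "\<And>v. v \<in> V \<Longrightarrow> wgrad \<Omega> v \<in> Lvar \<Omega> p"
    and u: "solves_weakly \<Omega> p f V u" and v: "v \<in> V" and \<epsilon>: "0 < \<epsilon>" "\<epsilon> \<le> 1"
  shows "energy \<Omega> p f v - energy \<Omega> p f u
    \<le> ((1 + \<epsilon>) powr M - 1 + \<epsilon>) * (LINT x|lebesgue_on \<Omega>. norm (wgrad \<Omega> u x) powr p x) +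
      ((1 + 1 / \<epsilon>) powr M + \<epsilon> powr (1 - M)) *
        (LINT x|lebesgue_on \<Omega>. norm (wgrad \<Omega> v x - wgrad \<Omega> u x) powr p x)"
proof -
  have uV: "u \<in> V" using u by (simp add: solves_weakly_def)
  note int = integrable_energy_density[OF p(1,2) V[OF uV]] integrable_energy_density[OF p(1,2) V[OF v]]
    integrable_flux_inner[OF p(1,2) V[OF uV] V[OF uV]] integrable_flux_inner[OF p(1,2) V[OF uV] V[OF v]]
    Lvar_integrable_powr[OF p(1) V[OF uV]] Lvar_integrable_powr[OF p(1) Lvar_diff[OF p V[OF v] V[OF uV]]]
  let ?a = "\<lambda>x. norm (wgrad \<Omega> u x) powr (p x - 2) *\<^sub>R wgrad \<Omega> u x"
  have "(LINT x|lebesgue_on \<Omega>. 1 / p x * norm (wgrad \<Omega> v x) powr p x - 1 / p x * norm (wgrad \<Omega> u x) powr p x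
        - (?a x \<bullet> wgrad \<Omega> v x - ?a x \<bullet> wgrad \<Omega> u x))
      \<le> (LINT x|lebesgue_on \<Omega>. ((1 + \<epsilon>) powr M - 1 + \<epsilon>) * norm (wgrad \<Omega> u x) powr p x +
        ((1 + 1 / \<epsilon>) powr M + \<epsilon> powr (1 - M)) * norm (wgrad \<Omega> v x - wgrad \<Omega> u x) powr p x)"
    using int powr_norm_excess[OF p(2,3) \<epsilon>] by (intro integral_mono) auto
  then show ?thesis
    unfolding energy_solution_eq[OF u uV] energy_solution_eq[OF u v] using int by simp
qed


lemma small_excess_coefficient:
  fixes M S e :: real
  assumes "0 < e"
  obtains \<epsilon> where "0 < \<epsilon>" "\<epsilon> \<le> 1" "((1 + \<epsilon>) powr M - 1 + \<epsilon>) * S < e"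
proof -
  have "((\<lambda>\<epsilon>. ((1 + \<epsilon>) powr M - 1 + \<epsilon>) * S) \<longlongrightarrow> ((1 + 0) powr M - 1 + 0) * S) (at_right 0)"
    by (intro tendsto_intros) auto
  then have "\<forall>\<^sub>F \<epsilon> in at_right 0. ((1 + \<epsilon>) powr M - 1 + \<epsilon>) * S < e"
    using assms by (intro order_tendstoD) auto
  moreover have "\<forall>\<^sub>F \<epsilon> in at_right 0. \<epsilon> \<in> {0<..<1::real}"
    by (rule eventually_at_right_real) simp
  ultimately have "\<forall>\<^sub>F \<epsilon> in at_right 0. 0 < \<epsilon> \<and> \<epsilon> \<le> 1 \<and> ((1 + \<epsilon>) powr M - 1 + \<epsilon>) * S < e"
    by eventually_elim auto
  then obtain \<epsilon> where "0 < \<epsilon> \<and> \<epsilon> \<le> 1 \<and> ((1 + \<epsilon>) powr M - 1 + \<epsilon>) * S < e"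
    using eventually_happens'[OF trivial_limit_at_right_real] by blast
  then show ?thesis using that by blast
qed

text \<open>
  The parameter \<open>\<epsilon>\<close> is chosen first, making the multiple of the modular of \<open>\<nabla>u\<close> small; it fixes the
  large constant \<open>B\<close>, against which the distance \<open>\<delta>\<close> of \<open>\<nabla>v\<close> to \<open>\<nabla>u\<close> is then chosen.
\<close>
lemma energy_near_solution:
  assumes \<Omega>: "open \<Omega>" "bounded \<Omega>" and p: "p \<in> C_plus \<Omega>"
    and dense: "dense_in_W10 \<Omega> p S" and u: "solves_weakly \<Omega> p f (W10 \<Omega> p) u" and e: "0 < e"
  obtains v where "v \<in> S" "energy \<Omega> p f v < energy \<Omega> p f u + e"
proof -
  obtain M where pM: "\<And>x. x \<in> \<Omega> \<Longrightarrow> 1 < p x" "\<And>x. x \<in> \<Omega> \<Longrightarrow> p x \<le> M"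
    using C_plus_bounds[OF \<Omega>(2) p] by blast
  note p_meas = C_plus_measurable[OF \<Omega>(1) p]
  have V: "wgrad \<Omega> v \<in> Lvar \<Omega> p" "weakly_differentiable \<Omega> v" if "v \<in> W10 \<Omega> p" for v
    using that by (auto simp: W10_def W1_def)
  have uV: "u \<in> W10 \<Omega> p" using u by (simp add: solves_weakly_def)
  let ?S = "LINT x|lebesgue_on \<Omega>. norm (wgrad \<Omega> u x) powr p x"
  obtain \<epsilon> where \<epsilon>: "0 < \<epsilon>" "\<epsilon> \<le> 1" "((1 + \<epsilon>) powr M - 1 + \<epsilon>) * ?S < e / 2"
    by (rule small_excess_coefficient[OF half_gt_zero[OF e]])
  define B where "B = (1 + 1 / \<epsilon>) powr M + \<epsilon> powr (1 - M)"
  have B: "0 \<le> B" by (simp add: B_def)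
  define \<delta> where "\<delta> = min 1 (e / (2 * (B + 1)))"
  have \<delta>: "0 < \<delta>" "\<delta> \<le> 1" using e B by (auto simp: \<delta>_def)
  obtain v where v: "v \<in> S" "W10_norm \<Omega> p (\<lambda>x. u x - v x) < \<delta>"
    using dense uV \<delta>(1) unfolding dense_in_W10_def by blast
  have vV: "v \<in> W10 \<Omega> p" using dense v(1) by (auto simp: dense_in_W10_def)
  have "Lvar_norm \<Omega> p (\<lambda>x. wgrad \<Omega> u x - wgrad \<Omega> v x) < \<delta>"
    using v(2) Lvar_norm_cong_AE[OF wgrad_diff[OF \<Omega>(1) V(2)[OF uV] V(2)[OF vV]]]
    by (simp add: W10_norm_def)
  then have "(LINT x|lebesgue_on \<Omega>. norm (wgrad \<Omega> u x - wgrad \<Omega> v x) powr p x) < \<delta>"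
    by (intro integral_powr_less_if_Lvar_norm_less p_meas pM(1) Lvar_diff[OF p_meas pM] V uV vV \<delta>)
  then have "B * (LINT x|lebesgue_on \<Omega>. norm (wgrad \<Omega> v x - wgrad \<Omega> u x) powr p x) \<le> B * \<delta>"
    using B by (intro mult_left_mono) (auto simp: norm_minus_commute)
  also have "\<dots> \<le> B * (e / (2 * (B + 1)))"
    using B by (intro mult_left_mono) (auto simp: \<delta>_def)
  also have "\<dots> \<le> e / 2"
    using B e by (simp add: field_simps)
  finally have "energy \<Omega> p f v - energy \<Omega> p f u < e"
    using energy_excess_le[OF p_meas pM V(1) u vV \<epsilon>(1,2)] \<epsilon>(3) unfolding B_def by linarith
  then show ?thesis using that v(1) by simp
qed

text \<open>
  The Galerkin energies are squeezed between that of \<open>u_star\<close>, which minimises over a larger space,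
  and that of any element of \<open>X M\<close>, over which \<open>u_N N\<close> minimises once \<open>N \<ge> M\<close>.
\<close>
theorem theorem4p4:
  fixes \<Omega> :: "(real ^ 'n) set"
    and p \<alpha> f u_star :: "real ^ 'n \<Rightarrow> real"
    and X :: "nat \<Rightarrow> (real ^ 'n \<Rightarrow> real) set"
    and u_N :: "nat \<Rightarrow> real ^ 'n \<Rightarrow> real"
  assumes dim: "CARD('n) \<in> {2, 3}"
    and domain: "open \<Omega>" "bounded \<Omega>" "lipschitz_boundary \<Omega>"
    and p: "p \<in> C_plus \<Omega>"
    and X_subspace: "\<And>N. fin_dim_subspace \<Omega> (X N)" "\<And>N. X N \<subseteq> W10inf \<Omega>"
    and X_nested: "\<And>N. X N \<subseteq> X (Suc N)"
    and X_dense: "dense_in_W10 \<Omega> p (\<Union>N. X N)"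
    and f: "f \<in> Lvar \<Omega> \<alpha>"
    and \<alpha>: "\<alpha> \<in> C_plus \<Omega>"
    and \<alpha>_p_star: "\<And>x. x \<in> \<Omega> \<Longrightarrow> 1 / ereal (\<alpha> x) + 1 / p_star p x < 1"
    and \<alpha>_min_2: "CARD('n) = 2 \<Longrightarrow> (INF x \<in> closure \<Omega>. \<alpha> x) > 1"
    and \<alpha>_min_3: "CARD('n) = 3 \<Longrightarrow> (INF x \<in> closure \<Omega>. \<alpha> x) \<ge> 6 / 5"
    and u_star: "solves_weakly \<Omega> p f (W10 \<Omega> p) u_star"
    and u_N: "\<And>N. solves_weakly \<Omega> p f (X N) (u_N N)"
  shows "(\<lambda>N. energy \<Omega> p f (u_N N)) \<longlonglongrightarrow> energy \<Omega> p f u_star"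
  proof (rule LIMSEQ_I)
  fix e :: real assume e: "0 < e"
  obtain v where v: "v \<in> (\<Union>N. X N)" "energy \<Omega> p f v < energy \<Omega> p f u_star + e"
    by (rule energy_near_solution[OF domain(1,2) p X_dense u_star e])
  then obtain M where M: "v \<in> X M" by auto
  have p_gt: "1 < p x" if "x \<in> \<Omega>" for x
    using C_plus_bounds[OF domain(2) p] that by blast
  note p_meas = C_plus_measurable[OF domain(1) p]
  have V: "wgrad \<Omega> v \<in> Lvar \<Omega> p" if "v \<in> W10 \<Omega> p" for v
    using that by (auto simp: W10_def W1_def)
  have X_sub: "X N \<subseteq> W10 \<Omega> p" for N
    using X_dense by (auto simp: dense_in_W10_def)
  have "norm (energy \<Omega> p f (u_N N) - energy \<Omega> p f u_star) < e" if "M \<le> N" for N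
  proof -
    have "v \<in> X N" using M lift_Suc_mono_le[of X, OF X_nested that] by blast
    then have "energy \<Omega> p f (u_N N) \<le> energy \<Omega> p f v"
      using X_sub V by (intro energy_solution_le[OF p_meas p_gt _ u_N[of N]]) auto
    moreover have "u_N N \<in> W10 \<Omega> p"
      using u_N[of N] X_sub by (auto simp: solves_weakly_def)
    then have "energy \<Omega> p f u_star \<le> energy \<Omega> p f (u_N N)"
      by (intro energy_solution_le[OF p_meas p_gt V u_star])
    ultimately show ?thesis using v(2) by simp
  qed
  then show "\<exists>no. \<forall>N\<ge>no. norm (energy \<Omega> p f (u_N N) - energy \<Omega> p f u_star) < e" by blast
qed

end
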